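(* Let $\mathrm{m}>0$, $\mathcal M,\mathcal M'>0$ and let $\mathbf x'\in\mathbb R^3$ be fixed. For $(\mathbf y,\mathbf x)\in\mathbb R^3\times\mathbb R^3$ with $\mathbf x\neq \mathbf 0$ and $\mathbf x\ne\mathbf x'$, consider the two-centre Hamiltonian $$\mathrm J(\mathbf y,\mathbf x)=\frac{\|\mathbf y\|^2}{2\mathrm m}-\frac{\mathrm m\mathcal M}{\|\mathbf x\|}-\frac{\mathrm m\mathcal M'}{\|\mathbf x'-\mathbf x\|}.$$ Put $\mathbf M=\mathbf x\times\mathbf y$ and $\mathbf L=\mathbf y\times\mathbf M-\mathrm m^2\mathcal M\,\dfrac{\mathbf x}{\|\mathbf x\|}$, and define $$\mathrm E(\mathbf y,\mathbf x)=\|\mathbf M\|^2-\mathbf x'\cdot\mathbf L+\mathrm m^2\mathcal M'\,\frac{(\mathbf x'-\mathbf x)\cdot\mathbf x'}{\|\mathbf x'-\mathbf x\|}.$$ Let $\mathrm E^{\rm sym}$ denote the Euler integral of the symmetric two-centre problem (see context). Then, evaluating $\mathrm E^{\rm sym}$ at $\mathbf v_0=\mathbf x'/2$, $\mathbf v=\mathbf x-\mathbf x'/2$, $\mathbf u=\mathbf y/\mathrm m$, $\mathrm m_+=\mathcal M$, $\mathrm m_-=\mathcal M'$, one has $$\mathrm m^2\,\mathrm E^{\rm sym}=\mathrm E+\frac{\mathrm m\|\mathbf x'\|^2}{2}\,\mathrm J .$$ In particular, $\mathrm E$ is a first integral of $\mathrm J$: it is constant along the solutions of Hamilton's equations $\dot{\mathbf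 x}=\partial_{\mathbf y}\mathrm J$, $\dot{\mathbf y}=-\partial_{\mathbf x}\mathrm J$.
   Context: The symmetric two-centre problem has centres at $\pm\mathbf v_0\in\mathbb R^3$ with masses $\mathrm m_\pm$, and Hamiltonian $\frac{\|\mathbf u\|^2}{2}-\frac{\mathrm m_+}{\|\mathbf v+\mathbf v_0\|}-\frac{\mathrm m_-}{\|\mathbf v-\mathbf v_0\|}$ with $\mathbf u=\dot{\mathbf v}$, $\mathbf v\ne\pm\mathbf v_0$. Its Euler integral is $$\mathrm E^{\rm sym}=\|\mathbf v\times\mathbf u\|^2+(\mathbf v_0\cdot\mathbf u)^2+2\,\mathbf v\cdot\mathbf v_0\left(\frac{\mathrm m_+}{\|\mathbf v+\mathbf v_0\|}-\frac{\mathrm m_-}{\|\mathbf v-\mathbf v_0\|}\right),$$ which is a first integral of that Hamiltonian. Here $\times$ is the cross product and $\|\cdot\|$ the Euclidean norm in $\mathbb R^3$. *)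

theory Defs
  imports "HOL-Analysis.Analysis"
begin

text \<open>
  Functions on phase space take the momentum \<open>y\<close> first and the position \<open>x\<close> second.
  The partial gradients in Hamilton's equations exist as part of the requirement; they are
  unique when they exist. Times range over an arbitrary interval, and derivatives at an end
  point belonging to the interval are one-sided.
\<close>

definition hamilton_solution ::
    "('a::real_inner \<Rightarrow> 'a \<Rightarrow> real) \<Rightarrow> ('a \<times> 'a) set \<Rightarrow> real set \<Rightarrow> (real \<Rightarrow> 'a) \<Rightarrow> (real \<Rightarrow> 'a) \<Rightarrow> bool"
  where
  "hamilton_solution H D I y x \<longleftrightarrow>
     is_interval I \<and>
     (\<forall>t\<in>I. (y t, x t) \<in> D \<and>
        (\<exists>Hy Hx.
           GDERIV (\<lambda>q. H q (x t)) (y t) :> Hy \<and>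
           GDERIV (\<lambda>q. H (y t) q) (x t) :> Hx \<and>
           (x has_vector_derivative Hy) (at t within I) \<and>
           (y has_vector_derivative - Hx) (at t within I)))"

definition first_integral ::
    "('a::real_inner \<Rightarrow> 'a \<Rightarrow> real) \<Rightarrow> ('a \<Rightarrow> 'a \<Rightarrow> real) \<Rightarrow> ('a \<times> 'a) set \<Rightarrow> bool"
  where
  "first_integral F H D \<longleftrightarrow>
     (\<forall>I y x. hamilton_solution H D I y x \<longrightarrow> (\<lambda>t. F (y t) (x t)) constant_on I)"

definition euler_integral_sym ::
    "real \<Rightarrow> real \<Rightarrow> real ^ 3 \<Rightarrow> real ^ 3 \<Rightarrow> real ^ 3 \<Rightarrow> real"
  where
  "euler_integral_sym mp mm v0 u v =
     (norm (cross3 v u))\<^sup>2 + (v0 \<bullet> u)\<^sup>2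
       + 2 * (v \<bullet> v0) * (mp / norm (v + v0) - mm / norm (v - v0))"

definition two_centre_domain :: "real ^ 3 \<Rightarrow> ((real ^ 3) \<times> (real ^ 3)) set"
  where
  "two_centre_domain x' = {(y, x). x \<noteq> 0 \<and> x \<noteq> x'}"

definition two_centre_hamiltonian ::
    "real \<Rightarrow> real \<Rightarrow> real \<Rightarrow> real ^ 3 \<Rightarrow> real ^ 3 \<Rightarrow> real ^ 3 \<Rightarrow> real"
  where
  "two_centre_hamiltonian m \<M> \<M>' x' y x =
     (norm y)\<^sup>2 / (2 * m) - m * \<M> / norm x - m * \<M>' / norm (x' - x)"

definition angular_momentum :: "real ^ 3 \<Rightarrow> real ^ 3 \<Rightarrow> real ^ 3"
  where
  "angular_momentum y x = cross3 x y"

definition lenz_vector :: "real \<Rightarrow> real \<Rightarrow> real ^ 3 \<Rightarrow> real ^ 3 \<Rightarrow> real ^ 3"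
  where
  "lenz_vector m \<M> y x =
     cross3 y (angular_momentum y x) - (m\<^sup>2 * \<M>) *\<^sub>R (x /\<^sub>R norm x)"

definition euler_integral ::
    "real \<Rightarrow> real \<Rightarrow> real \<Rightarrow> real ^ 3 \<Rightarrow> real ^ 3 \<Rightarrow> real ^ 3 \<Rightarrow> real"
  where
  "euler_integral m \<M> \<M>' x' y x =
     (norm (angular_momentum y x))\<^sup>2 - x' \<bullet> lenz_vector m \<M> y x
       + m\<^sup>2 * \<M>' * (((x' - x) \<bullet> x') / norm (x' - x))"

end

theory Submission
  imports Defs
begin

text \<open>
  The relation between the two Euler integrals follows from Lagrange's identity
  \<open>\<parallel>x' \<times> y\<parallel>\<^sup>2 + (x' \<bullet> y)\<^sup>2 = \<parallel>x'\<parallel>\<^sup>2 \<parallel>y\<parallel>\<^sup>2\<close>. The same identity expresses the Euler integral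
  by inner products only; along a solution these have derivatives that are again
  combinations of inner products, and conservation is a rational identity in them
  modulo \<open>\<parallel>x\<parallel>\<^sup>2 = x \<bullet> x\<close> and \<open>\<parallel>x' - x\<parallel>\<^sup>2 = x' \<bullet> x' - 2 x' \<bullet> x + x \<bullet> x\<close>.
\<close>

text \<open>Vector triple product: \<open>cross3 y (cross3 x y)\<close> is the combination of
  \<open>x\<close> and \<open>y\<close> with coefficients \<open>y \<bullet> y\<close> and
  \<open>- (x \<bullet> y)\<close>. This removes the cross products from the Lenz term.\<close>

lemma inner_cross3_cross3:
  "z \<bullet> cross3 y (cross3 x y) = (z \<bullet> x) * (y \<bullet> y) - (z \<bullet> y) * (x \<bullet> y)"
  by (simp add: Lagrange inner_diff_right inner_commute mult.commute)

lemma euler_integral_eq_inner: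
  "euler_integral m \<M> \<M>' x' y x =
     (x \<bullet> x) * (y \<bullet> y) - (x \<bullet> y)\<^sup>2 - (x' \<bullet> x) * (y \<bullet> y) + (x' \<bullet> y) * (x \<bullet> y)
       + m\<^sup>2 * \<M> * (x' \<bullet> x) / norm x + m\<^sup>2 * \<M>' * (x' \<bullet> x' - x' \<bullet> x) / norm (x' - x)"
  unfolding euler_integral_def lenz_vector_def angular_momentum_def
  by (simp add: norm_cross power2_norm_eq_inner[of x] power2_norm_eq_inner[of y]
      inner_cross3_cross3 inner_diff_right inner_diff_left inner_commute divide_inverse algebra_simps)

text \<open>The part quadratic in \<open>y\<close> exceeds that of \<open>euler_integral\<close> by
  |x'|^2 |y|^2 / 4, because two terms (x' . y)^2 / 4 cancel. The potential part exceeds it by - m^2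
  |x'|^2 / 2 times M/|x| + M'/|x' - x|. The sum of both is the stated multiple of the
  Hamiltonian.\<close>

lemma euler_integral_sym_eq:
  assumes "m > 0"
  shows "m\<^sup>2 * euler_integral_sym \<M> \<M>' (x' /\<^sub>R 2) (y /\<^sub>R m) (x - x' /\<^sub>R 2)
      = euler_integral m \<M> \<M>' x' y x
        + m * (norm x')\<^sup>2 / 2 * two_centre_hamiltonian m \<M> \<M>' x' y x"
proof -
  \<comment> \<open>The identity is linear in the reciprocal distances; kept as atoms, they leave no
    division by a distance to clear.\<close>
  define p q where "p = inverse (norm x)" and "q = inverse (norm (x' - x))"
  have "x - x' /\<^sub>R 2 + x' /\<^sub>R 2 = x" "x - x' /\<^sub>R 2 - x' /\<^sub>R 2 = x - x'"
    by (simp_all add: diff_diff_eq flip: scaleR_add_left)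
  then have sym: "euler_integral_sym \<M> \<M>' (x' /\<^sub>R 2) (y /\<^sub>R m) (x - x' /\<^sub>R 2) =
      (norm (cross3 (x - x' /\<^sub>R 2) (y /\<^sub>R m)))\<^sup>2 + ((x' /\<^sub>R 2) \<bullet> (y /\<^sub>R m))\<^sup>2
       + 2 * ((x - x' /\<^sub>R 2) \<bullet> (x' /\<^sub>R 2)) * (\<M> * p - \<M>' * q)"
    by (simp only: euler_integral_sym_def p_def q_def divide_inverse norm_minus_commute[of x x'])
  have E: "euler_integral m \<M> \<M>' x' y x =
     (x \<bullet> x) * (y \<bullet> y) - (x \<bullet> y)\<^sup>2 - (x' \<bullet> x) * (y \<bullet> y) + (x' \<bullet> y) * (x \<bullet> y)
       + m\<^sup>2 * \<M> * (x' \<bullet> x) * p + m\<^sup>2 * \<M>' * (x' \<bullet> x' - x' \<bullet> x) * q"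
    by (simp add: euler_integral_eq_inner p_def q_def divide_inverse)
  have J: "two_centre_hamiltonian m \<M> \<M>' x' y x = (y \<bullet> y) / (2 * m) - m * \<M> * p - m * \<M>' * q"
    by (simp add: two_centre_hamiltonian_def p_def q_def inverse_eq_divide power2_norm_eq_inner)
  have cross: "(norm (cross3 (x - x' /\<^sub>R 2) (y /\<^sub>R m)))\<^sup>2 =
      ((x \<bullet> x - x' \<bullet> x + x' \<bullet> x' / 4) * (y \<bullet> y) - (x \<bullet> y - x' \<bullet> y / 2)\<^sup>2) / m\<^sup>2"
    \<comment> \<open>Two separate rewrites, since \<open>power2_norm_eq_inner\<close> also matches
      the left side of \<open>norm_cross\<close>.\<close>
    unfolding norm_cross unfolding power2_norm_eq_inner using assms
    by (simp add: inner_diff_left inner_diff_right inner_commute[of x x'] field_simps power2_eq_square)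
  have dot: "((x' /\<^sub>R 2) \<bullet> (y /\<^sub>R m))\<^sup>2 = (x' \<bullet> y)\<^sup>2 / (4 * m\<^sup>2)"
    by (simp add: power2_eq_square field_simps)
  have dot': "(x - x' /\<^sub>R 2) \<bullet> (x' /\<^sub>R 2) = (x' \<bullet> x) / 2 - (x' \<bullet> x') / 4"
    by (simp add: inner_diff_left inner_commute[of x x'])
  show ?thesis
    unfolding sym E J cross dot dot' power2_norm_eq_inner[of x']
    using assms by (simp add: field_simps power2_eq_square)
qed

text \<open>Chain rule through \<open>c - q\<close>. A general \<open>c\<close> serves both centres:
  \<open>x'\<close> directly, and the origin as \<open>c = 0\<close>.\<close>

lemma has_derivative_norm_diff:
  fixes c x :: "'a::real_inner"
  assumes "x \<noteq> c"
  shows "((\<lambda>q. norm (c - q)) has_derivative (\<lambda>h. - (h \<bullet> (c - x)) / norm (c - x))) (at x)"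
proof -
  have "((\<lambda>q. c - q) has_derivative (\<lambda>h. - h)) (at x)"
    by (auto intro!: derivative_eq_intros)
  from has_derivative_compose[OF this has_derivative_norm] show ?thesis
    using assms by (simp add: sgn_div_norm divide_inverse mult.commute)
qed

lemma two_centre_hamiltonian_GDERIV_momentum:
  assumes "m > 0"
  shows "GDERIV (\<lambda>q. two_centre_hamiltonian m \<M> \<M>' x' q x) y :> y /\<^sub>R m"
  unfolding two_centre_hamiltonian_def gderiv_def power2_norm_eq_inner
  using assms
  by (auto intro!: derivative_eq_intros simp: inner_commute field_simps)

lemma two_centre_hamiltonian_GDERIV_position:
  assumes "x \<noteq> 0" "x \<noteq> x'"
  shows "GDERIV (\<lambda>q. two_centre_hamiltonian m \<M> \<M>' x' y q) x :>
    (m * \<M> / norm x ^ 3) *\<^sub>R x - (m * \<M>' / norm (x' - x) ^ 3) *\<^sub>R (x' - x)"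
proof -
  have 0: "((\<lambda>q. norm q) has_derivative (\<lambda>h. (h \<bullet> x) / norm x)) (at x)"
    using has_derivative_norm_diff[of x 0] assms by simp
  show ?thesis
    unfolding two_centre_hamiltonian_def gderiv_def
    using assms
    \<comment> \<open>The instance of \<open>inner_diff_right\<close> splits only the difference of
      the two scaled vectors and keeps \<open>x' - x\<close> whole, as it occurs in the derivative
      of the norm.\<close>
    by (auto intro!: derivative_eq_intros 0 has_derivative_norm_diff
        simp: inner_diff_right[of _ "_ *\<^sub>R _" "_ *\<^sub>R _"] fun_eq_iff inverse_eq_divide power3_eq_cube
        mult_ac)
qed

text \<open>\<open>hamilton_solution\<close> only asserts that some gradients exist. Their
  uniqueness identifies them with the computed ones, which gives Newton's equations with explicit
  attraction to both centres.\<close>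

lemma hamilton_solution_two_centre:
  assumes "m > 0"
    and "hamilton_solution (two_centre_hamiltonian m \<M> \<M>' x') (two_centre_domain x') I y x"
    and "t \<in> I"
  shows "x t \<noteq> 0" "x t \<noteq> x'"
    and "(x has_vector_derivative y t /\<^sub>R m) (at t within I)"
    and "(y has_vector_derivative (m * \<M>' / norm (x' - x t) ^ 3) *\<^sub>R (x' - x t)
            - (m * \<M> / norm (x t) ^ 3) *\<^sub>R x t) (at t within I)"
proof -
  have unique: "D = D'" if "GDERIV f z :> D" "GDERIV f z :> D'" for f and z D D' :: "real ^ 3"
    using has_derivative_unique[OF that[unfolded gderiv_def]] by (metis vector_eq_ldot)
  obtain Hy Hx where *: "x t \<noteq> 0" "x t \<noteq> x'"
    "GDERIV (\<lambda>q. two_centre_hamiltonian m \<M> \<M>' x' q (x t)) (y t) :> Hy"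
    "GDERIV (\<lambda>q. two_centre_hamiltonian m \<M> \<M>' x' (y t) q) (x t) :> Hx"
    "(x has_vector_derivative Hy) (at t within I)"
    "(y has_vector_derivative - Hx) (at t within I)"
    using assms(2,3) unfolding hamilton_solution_def two_centre_domain_def by blast
  have "Hy = y t /\<^sub>R m"
    using unique[OF *(3) two_centre_hamiltonian_GDERIV_momentum] assms(1) by blast
  moreover have "Hx = (m * \<M> / norm (x t) ^ 3) *\<^sub>R x t - (m * \<M>' / norm (x' - x t) ^ 3) *\<^sub>R (x' - x t)"
    using unique[OF *(4) two_centre_hamiltonian_GDERIV_position] * by blast
  ultimately show "x t \<noteq> 0" "x t \<noteq> x'"
    "(x has_vector_derivative y t /\<^sub>R m) (at t within I)"
    "(y has_vector_derivative (m * \<M>' / norm (x' - x t) ^ 3) *\<^sub>R (x' - x t)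
            - (m * \<M> / norm (x t) ^ 3) *\<^sub>R x t) (at t within I)"
    using * by simp_all
qed

lemma has_real_derivative_inner:
  fixes f g :: "real \<Rightarrow> 'a::real_inner"
  assumes "(f has_vector_derivative f') (at t within I)" "(g has_vector_derivative g') (at t within I)"
  shows "((\<lambda>t. f t \<bullet> g t) has_real_derivative f t \<bullet> g' + f' \<bullet> g t) (at t within I)"
  using has_derivative_inner[OF assms[unfolded has_vector_derivative_def]]
  by (auto simp: has_field_derivative_def fun_eq_iff algebra_simps elim!: has_derivative_eq_rhs)

lemma has_real_derivative_norm:
  fixes f :: "real \<Rightarrow> 'a::real_inner"
  assumes "(f has_vector_derivative f') (at t within I)" "f t \<noteq> 0"
  shows "((\<lambda>t. norm (f t)) has_real_derivative (f t \<bullet> f') / norm (f t)) (at t within I)"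
  using has_derivative_compose[OF assms(1)[unfolded has_vector_derivative_def]
      has_derivative_norm[OF assms(2)]]
  by (auto simp: has_field_derivative_def sgn_div_norm inner_commute divide_inverse fun_eq_iff
      mult_ac elim!: has_derivative_eq_rhs)

lemma euler_integral_derivative_zero:
  assumes "m > 0"
    and "hamilton_solution (two_centre_hamiltonian m \<M> \<M>' x') (two_centre_domain x') I y x"
    and "t \<in> I"
  shows "((\<lambda>t. euler_integral m \<M> \<M>' x' (y t) (x t)) has_real_derivative 0) (at t within I)"
proof -
  note sol = hamilton_solution_two_centre[OF assms]
  define r s a b c d e k where "r = norm (x t)" and "s = norm (x' - x t)"
    and "a = x t \<bullet> x t" and "b = y t \<bullet> y t" and "c = x t \<bullet> y t"
    and "d = x' \<bullet> x t" and "e = x' \<bullet> y t" and "k = x' \<bullet> x'"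
  \<comment> \<open>The strengths of the two central forces: along the solution y' = \<beta> (x' -
    x) - \<alpha> x.\<close>
  define \<alpha> \<beta> where "\<alpha> = m * \<M> / r ^ 3" and "\<beta> = m * \<M>' / s ^ 3"
  note names = r_def s_def a_def b_def c_def d_def e_def k_def
  have pos: "r > 0" "s > 0"
    using sol(1,2) by (auto simp: names)
  have rs: "r ^ 2 = a" "s ^ 2 = k - 2 * d + a"
    by (simp_all add: names power2_norm_eq_inner inner_diff_left inner_diff_right inner_commute)
  have x': "((\<lambda>t. x') has_vector_derivative 0) (at t within I)"
    by simp
  have dx: "(x has_vector_derivative y t /\<^sub>R m) (at t within I)"
    by (rule sol)
  have dy: "(y has_vector_derivative \<beta> *\<^sub>R (x' - x t) - \<alpha> *\<^sub>R x t) (at t within I)"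
    using sol(4) by (simp add: \<alpha>_def \<beta>_def r_def s_def)
  have dz: "((\<lambda>t. x' - x t) has_vector_derivative - (y t /\<^sub>R m)) (at t within I)"
    using has_vector_derivative_diff[OF x' dx] by simp
  have comm: "y t \<bullet> x t = x t \<bullet> y t" "x t \<bullet> x' = x' \<bullet> x t" "y t \<bullet> x' = x' \<bullet> y t"
    by (simp_all add: inner_commute)
  have D:
    "((\<lambda>t. x t \<bullet> x t) has_real_derivative 2 * c / m) (at t within I)"
    "((\<lambda>t. y t \<bullet> y t) has_real_derivative 2 * (\<beta> * (e - c) - \<alpha> * c)) (at t within I)"
    "((\<lambda>t. x t \<bullet> y t) has_real_derivative b / m + \<beta> * (d - a) - \<alpha> * a) (at t within I)"
    "((\<lambda>t. x' \<bullet> x t) has_real_derivative e / m) (at t within I)"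
    "((\<lambda>t. x' \<bullet> y t) has_real_derivative \<beta> * (k - d) - \<alpha> * d) (at t within I)"
    "((\<lambda>t. norm (x t)) has_real_derivative c / (m * r)) (at t within I)"
    "((\<lambda>t. norm (x' - x t)) has_real_derivative (c - e) / (m * s)) (at t within I)"
    using has_real_derivative_inner[OF dx dx] has_real_derivative_inner[OF dy dy]
      has_real_derivative_inner[OF dx dy] has_real_derivative_inner[OF x' dx]
      has_real_derivative_inner[OF x' dy] has_real_derivative_norm[OF dx sol(1)]
      has_real_derivative_norm[OF dz] sol(2)
    unfolding inner_diff_left inner_diff_right inner_scaleR_left inner_scaleR_right
      inner_minus_right inner_zero_left comm
    by (simp_all add: divide_inverse algebra_simps flip: names)
  have D6: "((\<lambda>t. m\<^sup>2 * \<M> * (x' \<bullet> x t) / norm (x t)) has_real_derivative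
      m * \<M> * e / r - \<alpha> * d * c) (at t within I)"
    by (rule derivative_eq_intros D refl)+
       (use pos assms(1) in \<open>auto simp: \<alpha>_def field_simps power3_eq_cube power2_eq_square
          simp flip: r_def d_def\<close>)
  have D7: "((\<lambda>t. m\<^sup>2 * \<M>' * (x' \<bullet> x' - x' \<bullet> x t) / norm (x' - x t)) has_real_derivative
      - (m * \<M>' * e / s) - \<beta> * (k - d) * (c - e)) (at t within I)"
    by (rule derivative_eq_intros D refl)+
       (use pos assms(1) in \<open>auto simp: \<beta>_def field_simps power3_eq_cube power2_eq_square
          simp flip: s_def d_def k_def\<close>)
  \<comment> \<open>The forces carry inverse cubes of the distances, while \<open>D6\<close> and
    \<open>D7\<close> also contain first inverse powers. The relations \<open>rs\<close> turn these
    into multiples of \<alpha> and \<beta>.\<close>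
  have \<alpha>: "m * \<M> * e / r = \<alpha> * a * e"
    unfolding rs(1)[symmetric] using pos by (simp add: \<alpha>_def power2_eq_square power3_eq_cube)
  have \<beta>: "m * \<M>' * e / s = \<beta> * (k - 2 * d + a) * e"
    unfolding rs(2)[symmetric] using pos by (simp add: \<beta>_def power2_eq_square power3_eq_cube)
  \<comment> \<open>The total derivative is now linear in 1/m, \<alpha> and \<beta> with polynomial
    coefficients in the inner products, and each of the three coefficients vanishes.\<close>
  show ?thesis
    unfolding euler_integral_eq_inner
    by (rule D D6[unfolded \<alpha>] D7[unfolded \<beta>] derivative_eq_intros refl)+
       (use assms(1) in \<open>simp add: field_simps flip: a_def b_def c_def d_def e_def\<close>)
qed

lemma euler_integral_first_integral:
  assumes "m > 0"
  shows "first_integral (euler_integral m \<M> \<M>' x') (two_centre_hamiltonian m \<M> \<M>' x')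
    (two_centre_domain x')"
  unfolding first_integral_def
proof (intro allI impI)
  fix I y x
  assume sol: "hamilton_solution (two_centre_hamiltonian m \<M> \<M>' x') (two_centre_domain x') I y x"
  then have "convex I"
    by (simp add: hamilton_solution_def is_interval_convex)
  \<comment> \<open>On a convex set a zero derivative within the set suffices, so end points with
    one-sided derivatives need no separate case.\<close>
  then show "(\<lambda>t. euler_integral m \<M> \<M>' x' (y t) (x t)) constant_on I"
    unfolding constant_on_def
    by (rule has_field_derivative_zero_constant)
       (rule euler_integral_derivative_zero[OF assms sol])
qed

theorem mainTheorem1:
  fixes m \<M> \<M>' :: real and x' :: "real ^ 3"
  assumes "m > 0" and "\<M> > 0" and "\<M>' > 0"
  shows "(\<forall>(y, x) \<in> two_centre_domain x'.
            m\<^sup>2 * euler_integral_sym \<M> \<M>' (x' /\<^sub>R 2) (y /\<^sub>R m) (x - x' /\<^sub>R 2)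
              = euler_integral m \<M> \<M>' x' y x
                + m * (norm x')\<^sup>2 / 2 * two_centre_hamiltonian m \<M> \<M>' x' y x)
       \<and> first_integral (euler_integral m \<M> \<M>' x') (two_centre_hamiltonian m \<M> \<M>' x')
            (two_centre_domain x')"
  using euler_integral_sym_eq[OF assms(1)] euler_integral_first_integral[OF assms(1)] by auto

end
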